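(* (Generalized Ladyzhenskaya inequality.) For every real $r\ge2$ and every $u\in C_0^\infty(\mathbb R^2)$, $$\|u\|^2_{L^{2r}(\mathbb R^2)}\le\frac{r}{\sqrt2}\,\|u\|_{L^r(\mathbb R^2)}\,\|\nabla u\|_{L^2(\mathbb R^2)}.$$
   Context: $C_0^\infty(\mathbb R^2)$ denotes smooth compactly supported functions on $\mathbb R^2$, and $\|\nabla u\|_{L^2(\mathbb R^2)}=\big(\int_{\mathbb R^2}|\nabla u|^2dx\big)^{1/2}$ with $|\nabla u|$ the Euclidean norm of the gradient. *)

theory Defs
  imports "HOL-Analysis.Analysis"
begin

primrec higher_differentiable :: "nat \<Rightarrow> ('a::euclidean_space \<Rightarrow> real) \<Rightarrow> bool" where
  "higher_differentiable 0 f \<longleftrightarrow> continuous_on UNIV f"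
| "higher_differentiable (Suc k) f \<longleftrightarrow>
     (\<forall>x. f differentiable (at x)) \<and>
     (\<forall>v. higher_differentiable k (\<lambda>x. frechet_derivative f (at x) v))"

definition smooth :: "('a::euclidean_space \<Rightarrow> real) \<Rightarrow> bool" where
  "smooth f \<longleftrightarrow> (\<forall>k. higher_differentiable k f)"

definition support :: "('a::topological_space \<Rightarrow> real) \<Rightarrow> 'a set" where
  "support f = closure {x. f x \<noteq> 0}"

definition test_functions :: "('a::euclidean_space \<Rightarrow> real) set" where
  "test_functions = {f. smooth f \<and> compact (support f)}"

definition gradient :: "('a::euclidean_space \<Rightarrow> real) \<Rightarrow> 'a \<Rightarrow> 'a" where
  "gradient f x = (\<Sum>b\<in>Basis. frechet_derivative f (at x) b *\<^sub>R b)"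

lemma GDERIV_gradient:
  assumes "f differentiable (at x)"
  shows "GDERIV f x :> gradient f x"
proof -
  have D: "(f has_derivative frechet_derivative f (at x)) (at x)"
    using assms by (simp add: frechet_derivative_works)
  then have "linear (frechet_derivative f (at x))"
    by (rule has_derivative_linear)
  then have "frechet_derivative f (at x) h = h \<bullet> gradient f x" for h
    by (subst euclidean_representation[symmetric, of h])
       (simp add: linear_sum linear_scale gradient_def inner_sum_right mult.commute)
  then have "frechet_derivative f (at x) = (\<lambda>h. h \<bullet> gradient f x)" ..
  with D show ?thesis
    by (simp add: gderiv_def)
qed

text \<open>
  The Bochner integral is 0 on functions that are not integrable, so the value is the
  \<open>L\<^sup>p\<close> norm only when \<open>f\<close> is \<open>p\<close>-integrable. This is automatic for test functions and their
  gradients: they are continuous with compact support.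
\<close>

definition Lp_norm :: "real \<Rightarrow> ('a::euclidean_space \<Rightarrow> 'b::real_normed_vector) \<Rightarrow> real" where
  "Lp_norm p f = (LINT x|lborel. norm (f x) powr p) powr (1 / p)"

end

theory Submission
  imports Defs
begin

text \<open>
  Integrating \<open>\<partial>\<^sub>i \<bar>u\<bar>\<^sup>r\<close> along the two coordinate lines through a point bounds \<open>\<bar>u\<bar>\<^sup>r\<close> there by
  \<open>r \<integral> \<bar>u\<bar>\<^sup>r\<^sup>-\<^sup>1 \<bar>\<partial>\<^sub>1 u\<bar> dx\<^sub>1\<close> and by \<open>r \<integral> \<bar>u\<bar>\<^sup>r\<^sup>-\<^sup>1 \<bar>\<partial>\<^sub>2 u\<bar> dx\<^sub>2\<close>. Multiplying the two bounds and
  integrating over the plane gives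
  \<open>\<integral> \<bar>u\<bar>\<^sup>2\<^sup>r \<le> r\<^sup>2 (\<integral> \<bar>u\<bar>\<^sup>r\<^sup>-\<^sup>1 \<bar>\<partial>\<^sub>1 u\<bar>) (\<integral> \<bar>u\<bar>\<^sup>r\<^sup>-\<^sup>1 \<bar>\<partial>\<^sub>2 u\<bar>)\<close>. By Cauchy-Schwarz and AM-GM the right-hand
  side is at most \<open>(r\<^sup>2 / 2) \<integral> \<bar>u\<bar>\<^sup>2\<^sup>r\<^sup>-\<^sup>2 \<integral> \<bar>\<nabla>u\<bar>\<^sup>2\<close>, and Hoelder interpolates the exponent
  \<open>2r - 2\<close> between \<open>r\<close> and \<open>2r\<close>.
\<close>

section \<open>Hoelder's inequality with weights \<open>\<theta>\<close> and
  \<open>1 - \<theta>\<close>\<close>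

lemma Holder_integral:
  fixes f g :: "'a \<Rightarrow> real"
  assumes f: "integrable M f" and g: "integrable M g"
    and f_nonneg: "\<And>x. 0 \<le> f x" and g_nonneg: "\<And>x. 0 \<le> g x"
    and \<theta>: "0 \<le> \<theta>" "\<theta> \<le> 1"
  shows "(\<integral>x. f x powr \<theta> * g x powr (1 - \<theta>) \<partial>M)
           \<le> (\<integral>x. f x \<partial>M) powr \<theta> * (\<integral>x. g x \<partial>M) powr (1 - \<theta>)"
proof -
  let ?F = "\<integral>x. f x \<partial>M" and ?G = "\<integral>x. g x \<partial>M"
  have "0 \<le> ?F" "0 \<le> ?G"
    using f_nonneg g_nonneg by auto
  then consider "?F = 0 \<or> ?G = 0" | "?F > 0" "?G > 0"
    by linarith
  then show ?thesis
  proof cases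
    case 1
    \<comment> \<open>A nonnegative integrable function with integral 0 vanishes almost everywhere.
      Since \<open>0 powr \<theta> = 0\<close> even for \<open>\<theta> = 0\<close>, so does the
      product.\<close>
    then have "(AE x in M. f x = 0) \<or> (AE x in M. g x = 0)"
      using integral_nonneg_eq_0_iff_AE f g f_nonneg g_nonneg by (metis AE_I2)
    then have "AE x in M. f x powr \<theta> * g x powr (1 - \<theta>) = 0"
      by auto
    then have "(\<integral>x. f x powr \<theta> * g x powr (1 - \<theta>) \<partial>M) = 0"
      by (rule integral_eq_zero_AE)
    then show ?thesis
      by simp
  next
    case 2
    \<comment> \<open>Weighted AM-GM for the normalised functions \<open>f / ?F\<close> and
      \<open>g / ?G\<close>, scaled back. As the weights add up to 1, \<open>?h\<close> integrates
      to exactly the right-hand side.\<close>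
    let ?h = "\<lambda>x. ?F powr \<theta> * ?G powr (1 - \<theta>) * (\<theta> * (f x / ?F) + (1 - \<theta>) * (g x / ?G))"
    have le: "f x powr \<theta> * g x powr (1 - \<theta>) \<le> ?h x" for x
    proof (cases "f x = 0 \<or> g x = 0")
      case True
      then show ?thesis
        using 2 \<theta> f_nonneg[of x] g_nonneg[of x] by auto
    next
      case False
      then have "(f x / ?F) powr \<theta> * (g x / ?G) powr (1 - \<theta>)
                   \<le> \<theta> * (f x / ?F) + (1 - \<theta>) * (g x / ?G)"
        using 2 \<theta> f_nonneg[of x] g_nonneg[of x] by (intro Youngs_inequality_0) auto
      then show ?thesis
        using 2 f_nonneg[of x] g_nonneg[of x] by (simp add: powr_divide field_simps)
    qed
    \<comment> \<open>\<open>integral_mono'\<close> takes integrability from the nonnegative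
      majorant \<open>?h\<close> alone: a left integrand that is not integrable would have integral
      0.\<close>
    have "(\<integral>x. f x powr \<theta> * g x powr (1 - \<theta>) \<partial>M) \<le> (\<integral>x. ?h x \<partial>M)"
      using f g le 2 \<theta> f_nonneg g_nonneg
      by (intro integral_mono') (auto intro!: mult_nonneg_nonneg add_nonneg_nonneg)
    also have "\<dots> = ?F powr \<theta> * ?G powr (1 - \<theta>)"
      using f g 2 by simp
    finally show ?thesis .
  qed
qed

section \<open>Powers of functions on the line\<close>

lemma has_real_derivative_abs_powr:
  fixes x :: real
  assumes "p > 1"
  shows "((\<lambda>t. \<bar>t\<bar> powr p) has_real_derivative p * \<bar>x\<bar> powr (p - 1) * sgn x) (at x)"
proof (cases "x = 0")
  case True
  \<comment> \<open>At 0 the difference quotient has absolute value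
    \<open>\<bar>y\<bar> powr (p - 1)\<close>, which tends to 0 because \<open>p > 1\<close>; this
    matches the formula, as \<open>sgn 0 = 0\<close>.\<close>
  have "((\<lambda>y::real. \<bar>y\<bar> powr (p - 1)) \<longlongrightarrow> \<bar>0\<bar> powr (p - 1)) (at 0)"
    using assms by (intro tendsto_powr' tendsto_intros) auto
  then have lim: "((\<lambda>y::real. \<bar>y\<bar> powr (p - 1)) \<longlongrightarrow> 0) (at 0)"
    by simp
  have "\<forall>\<^sub>F y in at 0. norm ((\<bar>y\<bar> powr p - \<bar>0\<bar> powr p) / (y - 0)) \<le> \<bar>y\<bar> powr (p - 1)"
    by (intro always_eventually) (simp add: powr_diff)
  then have "((\<lambda>y::real. (\<bar>y\<bar> powr p - \<bar>0\<bar> powr p) / (y - 0)) \<longlongrightarrow> 0) (at 0)"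
    using lim by (rule Lim_null_comparison)
  then show ?thesis
    using True by (simp add: has_field_derivative_iff)
next
  case False
  have "(abs has_real_derivative sgn x) (at x)"
    using GDERIV_norm[OF False] by (simp add: real_norm_def[abs_def])
  then show ?thesis
    using False by (auto intro!: derivative_eq_intros simp: powr_diff)
qed

text \<open>The fundamental theorem of calculus for \<open>\<bar>g\<bar> powr p\<close>, started at
  a point where \<open>g\<close> vanishes. Extending the integral to the whole line only enlarges
  it, and the nonnegative integral makes this meaningful without a separate integrability
  argument.\<close>

lemma abs_powr_le_nn_integral_deriv:
  fixes g g' :: "real \<Rightarrow> real"
  assumes p: "p > 1" and deriv: "\<And>x. (g has_real_derivative g' x) (at x)"
    and cont: "continuous_on UNIV g'" and bdd: "bounded {x. g x \<noteq> 0}"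
  shows "ennreal (\<bar>g x\<bar> powr p) \<le> (\<integral>\<^sup>+ s. ennreal (p * \<bar>g s\<bar> powr (p - 1) * \<bar>g' s\<bar>) \<partial>lborel)"
proof -
  let ?k = "\<lambda>s. p * \<bar>g s\<bar> powr (p - 1) * \<bar>g' s\<bar>"
  obtain M where M: "\<And>x. g x \<noteq> 0 \<Longrightarrow> \<bar>x\<bar> \<le> M"
    using bdd by (auto simp: bounded_iff)
  \<comment> \<open>Left of \<open>x\<close> and of absolute value greater than \<open>M\<close>, so
    the boundary term at \<open>a\<close> is 0.\<close>
  define a where "a = min x (- \<bar>M\<bar> - 1)"
  have "a \<le> x" "a \<le> - \<bar>M\<bar> - 1"
    by (auto simp: a_def)
  then have "g a = 0"
    using M[of a] by linarith
  have "continuous_on UNIV g"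
    using deriv by (meson DERIV_isCont continuous_at_imp_continuous_on)
  then have "continuous_on UNIV ?k"
    using p cont by (intro continuous_intros continuous_on_powr') auto
  then have "continuous_on {a..x} ?k"
    by (rule continuous_on_subset) auto
  then have k: "(?k has_integral integral {a..x} ?k) {a..x}"
    by (intro integrable_integral integrable_continuous_real)
  let ?h' = "\<lambda>s. p * \<bar>g s\<bar> powr (p - 1) * sgn (g s) * g' s"
  have "((\<lambda>s. \<bar>g s\<bar> powr p) has_real_derivative ?h' s) (at s)" for s
    using DERIV_chain2[OF has_real_derivative_abs_powr[OF p] deriv] .
  then have h: "(?h' has_integral (\<bar>g x\<bar> powr p - \<bar>g a\<bar> powr p)) {a..x}"
    using \<open>a \<le> x\<close>
    by (intro fundamental_theorem_of_calculus)
       (auto simp: has_real_derivative_iff_has_vector_derivative intro: has_vector_derivative_at_within)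
  have "?h' s \<le> ?k s" for s
  proof -
    have "sgn (g s) * g' s \<le> \<bar>g' s\<bar>"
      by (auto simp: sgn_if)
    then show ?thesis
      using p by (simp add: mult.assoc mult_left_mono)
  qed
  then have "\<bar>g x\<bar> powr p \<le> integral {a..x} ?k"
    using has_integral_le[OF h k] \<open>g a = 0\<close> by simp
  then have "ennreal (\<bar>g x\<bar> powr p) \<le> ennreal (integral {a..x} ?k)"
    by (rule ennreal_leI)
  also have "\<dots> = (\<integral>\<^sup>+ s. ennreal (?k s) * indicator {a..x} s \<partial>lborel)"
    using p by (intro nn_integral_has_integral_lebesgue'[OF _ k, symmetric]) auto
  also have "\<dots> \<le> (\<integral>\<^sup>+ s. ennreal (?k s) \<partial>lborel)"
    by (intro nn_integral_mono) (auto split: split_indicator)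
  finally show ?thesis .
qed

section \<open>Tonelli's theorem on \<open>real ^ 2\<close>\<close>

definition plane_point :: "real \<Rightarrow> real \<Rightarrow> real ^ 2" where
  "plane_point s t = s *\<^sub>R axis 1 1 + t *\<^sub>R axis 2 1"

lemma plane_point_nth [simp]: "plane_point s t $ 1 = s" "plane_point s t $ 2 = t"
  by (simp_all add: plane_point_def axis_def)

lemma Basis_real2: "(Basis :: (real ^ 2) set) = {axis 1 1, axis 2 1}"
  by (auto simp: Basis_vec_def UNIV_2)

lemma axis_1_neq_axis_2: "axis 1 1 \<noteq> (axis 2 1 :: real ^ 2)"
  by (simp add: axis_eq_axis)

lemma plane_point_measurable [measurable]:
  "(\<lambda>z. plane_point (fst z) (snd z)) \<in> borel_measurable (lborel \<Otimes>\<^sub>M lborel)"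
  unfolding lborel_prod plane_point_def measurable_lborel2
  by (intro borel_measurable_continuous_onI continuous_intros)

text \<open>Lebesgue measure is determined by its values on boxes, and the preimage of a box is a
  product of two intervals. This transports Tonelli's theorem from pairs of reals to
  \<open>real ^ 2\<close>.\<close>

lemma lborel_eq_distr_plane_point:
  "(lborel :: (real ^ 2) measure)
     = distr (lborel \<Otimes>\<^sub>M lborel) borel (\<lambda>z. plane_point (fst z) (snd z))"
proof (rule lborel_eqI)
  fix l u :: "real ^ 2"
  assume le: "\<And>b. b \<in> Basis \<Longrightarrow> l \<bullet> b \<le> u \<bullet> b"
  have le': "l $ 1 \<le> u $ 1" "l $ 2 \<le> u $ 2"
    using le[of "axis 1 1"] le[of "axis 2 1"] by (auto simp: Basis_real2 inner_axis)
  have "(\<lambda>z. plane_point (fst z) (snd z)) -` box l u \<inter> space (lborel \<Otimes>\<^sub>M lborel)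
          = {l $ 1 <..< u $ 1} \<times> {l $ 2 <..< u $ 2}"
    by (auto simp: mem_box_cart forall_2 space_pair_measure)
  then have "emeasure (distr (lborel \<Otimes>\<^sub>M lborel) borel (\<lambda>z. plane_point (fst z) (snd z))) (box l u)
          = emeasure (lborel \<Otimes>\<^sub>M lborel) ({l $ 1 <..< u $ 1} \<times> {l $ 2 <..< u $ 2})"
    by (subst emeasure_distr) auto
  also have "\<dots> = ennreal (u $ 1 - l $ 1) * ennreal (u $ 2 - l $ 2)"
    using le' by (subst lborel.emeasure_pair_measure_Times) auto
  also have "\<dots> = (\<Prod>b\<in>Basis. (u - l) \<bullet> b)"
    using le' axis_1_neq_axis_2 by (simp add: Basis_real2 inner_axis ennreal_mult)
  finally show "emeasure (distr (lborel \<Otimes>\<^sub>M lborel) borel (\<lambda>z. plane_point (fst z) (snd z))) (box l u)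
          = (\<Prod>b\<in>Basis. (u - l) \<bullet> b)" .
qed simp

lemma nn_integral_plane:
  fixes f :: "real ^ 2 \<Rightarrow> ennreal"
  assumes [measurable]: "f \<in> borel_measurable borel"
  shows "(\<integral>\<^sup>+ x. f x \<partial>lborel) = (\<integral>\<^sup>+ z. f (plane_point (fst z) (snd z)) \<partial>(lborel \<Otimes>\<^sub>M lborel))"
  by (subst lborel_eq_distr_plane_point, subst nn_integral_distr) auto

text \<open>The bound by \<open>k1\<close> depends only on the second coordinate and the bound by
  \<open>k2\<close> only on the first, so the integral of their product splits into a product of
  integrals.\<close>

lemma nn_integral_plane_square_le:
  fixes w k1 k2 :: "real ^ 2 \<Rightarrow> ennreal"
  assumes [measurable]: "w \<in> borel_measurable borel" "k1 \<in> borel_measurable borel"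
      "k2 \<in> borel_measurable borel"
    and k1: "\<And>s t. w (plane_point s t) \<le> (\<integral>\<^sup>+ \<sigma>. k1 (plane_point \<sigma> t) \<partial>lborel)"
    and k2: "\<And>s t. w (plane_point s t) \<le> (\<integral>\<^sup>+ \<tau>. k2 (plane_point s \<tau>) \<partial>lborel)"
  shows "(\<integral>\<^sup>+ x. w x * w x \<partial>lborel) \<le> (\<integral>\<^sup>+ x. k1 x \<partial>lborel) * (\<integral>\<^sup>+ x. k2 x \<partial>lborel)"
proof -
  have [measurable]: "(\<lambda>z. f (plane_point (fst z) (snd z))) \<in> borel_measurable (lborel \<Otimes>\<^sub>M lborel)"
    if "f \<in> borel_measurable borel" for f :: "real ^ 2 \<Rightarrow> ennreal"
    using measurable_compose[OF plane_point_measurable that] .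
  let ?F = "\<lambda>t. \<integral>\<^sup>+ \<sigma>. k1 (plane_point \<sigma> t) \<partial>lborel"
  let ?G = "\<lambda>s. \<integral>\<^sup>+ \<tau>. k2 (plane_point s \<tau>) \<partial>lborel"
  have [measurable]: "?G \<in> borel_measurable lborel"
    using lborel.borel_measurable_nn_integral[of "\<lambda>s \<tau>. k2 (plane_point s \<tau>)" lborel]
    by (simp add: case_prod_unfold)
  \<comment> \<open>Here the first coordinate is integrated out, so the pair has to be
    swapped.\<close>
  have [measurable]: "?F \<in> borel_measurable lborel"
    using lborel.borel_measurable_nn_integral[of "\<lambda>t \<sigma>. k1 (plane_point \<sigma> t)" lborel]
      measurable_pair_swap[of "\<lambda>z. k1 (plane_point (fst z) (snd z))"]
    by (simp add: case_prod_unfold)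
  have "(\<integral>\<^sup>+ x. w x * w x \<partial>lborel)
          = (\<integral>\<^sup>+ z. w (plane_point (fst z) (snd z)) * w (plane_point (fst z) (snd z)) \<partial>(lborel \<Otimes>\<^sub>M lborel))"
    by (rule nn_integral_plane) simp
  also have "\<dots> \<le> (\<integral>\<^sup>+ z. ?F (snd z) * ?G (fst z) \<partial>(lborel \<Otimes>\<^sub>M lborel))"
    by (intro nn_integral_mono mult_mono k1 k2) auto
  also have "\<dots> = (\<integral>\<^sup>+ s. \<integral>\<^sup>+ t. ?F t * ?G s \<partial>lborel \<partial>lborel)"
    by (subst lborel.nn_integral_fst[symmetric]) auto
  also have "\<dots> = (\<integral>\<^sup>+ t. ?F t \<partial>lborel) * (\<integral>\<^sup>+ s. ?G s \<partial>lborel)"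
    by (simp add: nn_integral_multc nn_integral_cmult)
  also have "(\<integral>\<^sup>+ s. ?G s \<partial>lborel) = (\<integral>\<^sup>+ x. k2 x \<partial>lborel)"
    using lborel.nn_integral_fst[of "\<lambda>z. k2 (plane_point (fst z) (snd z))"]
    by (simp add: nn_integral_plane)
  also have "(\<integral>\<^sup>+ t. ?F t \<partial>lborel) = (\<integral>\<^sup>+ x. k1 x \<partial>lborel)"
    using lborel_pair.nn_integral_snd[of "\<lambda>z. k1 (plane_point (fst z) (snd z))"]
    by (simp add: nn_integral_plane)
  finally show ?thesis .
qed

section \<open>Integrability and line estimates for test functions\<close>

lemma integrable_continuous_compact_support:
  fixes f :: "'a::euclidean_space \<Rightarrow> real"
  assumes "compact K" "continuous_on UNIV f" "\<And>x. x \<notin> K \<Longrightarrow> f x = 0"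
  shows "integrable lborel f"
proof -
  have "integrable lborel (\<lambda>x. indicator K x *\<^sub>R f x)"
    using assms by (intro borel_integrable_compact) (auto intro: continuous_on_subset)
  also have "(\<lambda>x. indicator K x *\<^sub>R f x) = f"
    using assms(3) by (auto simp: fun_eq_iff split: split_indicator)
  finally show ?thesis .
qed

lemma norm_gradient_squared: "(norm (gradient f x))\<^sup>2 = (\<Sum>b\<in>Basis. (frechet_derivative f (at x) b)\<^sup>2)"
proof -
  have "gradient f x \<bullet> b = frechet_derivative f (at x) b" if "b \<in> Basis" for b
    using that by (simp add: gradient_def)
  moreover have "(norm (gradient f x))\<^sup>2 = (\<Sum>b\<in>Basis. (gradient f x \<bullet> b) * (gradient f x \<bullet> b))"
    unfolding power2_norm_eq_inner by (rule euclidean_inner)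
  ultimately show ?thesis
    by (simp add: power2_eq_square)
qed

locale test_function =
  fixes u :: "'a::euclidean_space \<Rightarrow> real"
  assumes test: "u \<in> test_functions"
begin

lemma differentiable: "u differentiable (at x)"
proof -
  have "higher_differentiable (Suc 0) u"
    using test unfolding test_functions_def smooth_def by blast
  then show ?thesis
    by simp
qed

lemma continuous: "continuous_on UNIV u"
  using differentiable
  by (meson continuous_at_imp_continuous_on differentiable_imp_continuous_within)

lemma continuous_derivative: "continuous_on UNIV (\<lambda>x. frechet_derivative u (at x) v)"
proof -
  have "higher_differentiable (Suc 0) u"
    using test unfolding test_functions_def smooth_def by blast
  then show ?thesis
    by simp
qed

lemma compact_support: "compact (support u)"
  using test by (simp add: test_functions_def)

lemma eq_0_outside_support: "x \<notin> support u \<Longrightarrow> u x = 0"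
  using closure_subset[of "{x. u x \<noteq> 0}"] by (auto simp: support_def)

text \<open>The support is closed, so \<open>u\<close> vanishes on a whole neighbourhood of
  \<open>x\<close>.\<close>

lemma derivative_eq_0_outside_support:
  assumes "x \<notin> support u"
  shows "frechet_derivative u (at x) v = 0"
proof -
  have "(u has_derivative (\<lambda>_. 0)) (at x)"
  proof (rule has_derivative_transform_within_open)
    show "((\<lambda>_. 0) has_derivative (\<lambda>_. 0)) (at x)"
      by (rule has_derivative_const)
    show "open (- support u)" "x \<in> - support u"
      using assms by (simp_all add: support_def open_Compl)
    show "0 = u y" if "y \<in> - support u" for y
      using that eq_0_outside_support by simp
  qed
  then show ?thesis
    by (metis frechet_derivative_at)
qed

lemma continuous_abs_powr: "p > 0 \<Longrightarrow> continuous_on UNIV (\<lambda>x. \<bar>u x\<bar> powr p)"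
  using continuous by (intro continuous_on_powr' continuous_intros) auto

lemma integrable_abs_powr: "p > 0 \<Longrightarrow> integrable lborel (\<lambda>x. \<bar>u x\<bar> powr p)"
  using continuous_abs_powr
  by (intro integrable_continuous_compact_support[OF compact_support])
     (auto simp: eq_0_outside_support)

lemma integrable_derivative_squared: "integrable lborel (\<lambda>x. (frechet_derivative u (at x) v)\<^sup>2)"
  using continuous_derivative
  by (intro integrable_continuous_compact_support[OF compact_support] continuous_intros)
     (auto simp: derivative_eq_0_outside_support)

text \<open>The one-dimensional estimate for the restriction of \<open>u\<close> to a line. With
  \<open>b \<noteq> 0\<close>, boundedness of the support passes to the parameters
  \<open>s\<close>.\<close>

lemma line_bound:
  assumes p: "p > 1" and b: "b \<noteq> 0"
  shows "ennreal (\<bar>u (x + t *\<^sub>R b)\<bar> powr p)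
    \<le> (\<integral>\<^sup>+ s. ennreal (p * \<bar>u (x + s *\<^sub>R b)\<bar> powr (p - 1)
                    * \<bar>frechet_derivative u (at (x + s *\<^sub>R b)) b\<bar>) \<partial>lborel)"
proof (rule abs_powr_le_nn_integral_deriv[OF p])
  fix t
  have "(u has_derivative frechet_derivative u (at (x + t *\<^sub>R b))) (at (x + t *\<^sub>R b))"
    using differentiable by (simp add: frechet_derivative_works)
  moreover have "((\<lambda>s. x + s *\<^sub>R b) has_derivative (\<lambda>h. h *\<^sub>R b)) (at t)"
    by (auto intro!: derivative_eq_intros)
  ultimately have D: "((\<lambda>s. u (x + s *\<^sub>R b)) has_derivative
      (\<lambda>h. frechet_derivative u (at (x + t *\<^sub>R b)) (h *\<^sub>R b))) (at t)"
    by (rule has_derivative_compose[rotated])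
  have "linear (frechet_derivative u (at (x + t *\<^sub>R b)))"
    using differentiable by (simp add: linear_frechet_derivative)
  then have "(\<lambda>h. frechet_derivative u (at (x + t *\<^sub>R b)) (h *\<^sub>R b))
      = (*) (frechet_derivative u (at (x + t *\<^sub>R b)) b)"
    by (auto simp: fun_eq_iff linear_scale)
  then show "((\<lambda>s. u (x + s *\<^sub>R b)) has_real_derivative frechet_derivative u (at (x + t *\<^sub>R b)) b) (at t)"
    using D by (simp add: has_field_derivative_def)
next
  show "continuous_on UNIV (\<lambda>t. frechet_derivative u (at (x + t *\<^sub>R b)) b)"
    by (rule continuous_on_compose2[OF continuous_derivative]) (auto intro!: continuous_intros)
next
  obtain M where M: "\<And>y. y \<in> support u \<Longrightarrow> norm y \<le> M"
    using compact_imp_bounded[OF compact_support] by (auto simp: bounded_iff)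
  have "\<bar>s\<bar> \<le> (M + norm x) / norm b" if "u (x + s *\<^sub>R b) \<noteq> 0" for s
  proof -
    have "norm (x + s *\<^sub>R b) \<le> M"
      using that M eq_0_outside_support by blast
    then have "norm (s *\<^sub>R b) \<le> M + norm x"
      using norm_triangle_ineq4[of "x + s *\<^sub>R b" x] by simp
    then show ?thesis
      using b by (simp add: field_simps)
  qed
  then show "bounded {s. u (x + s *\<^sub>R b) \<noteq> 0}"
    by (auto simp: bounded_iff)
qed

lemma integral_derivative_le:
  assumes r: "r > 1"
  shows "(\<integral>\<^sup>+ x. ennreal (r * \<bar>u x\<bar> powr (r - 1) * \<bar>frechet_derivative u (at x) v\<bar>) \<partial>lborel)
    \<le> ennreal (r * (sqrt (\<integral>x. \<bar>u x\<bar> powr (2 * r - 2) \<partial>lborel)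
                    * sqrt (\<integral>x. (frechet_derivative u (at x) v)\<^sup>2 \<partial>lborel)))"
proof -
  let ?d = "\<lambda>x. frechet_derivative u (at x) v"
  have "continuous_on UNIV (\<lambda>x. r * \<bar>u x\<bar> powr (r - 1) * \<bar>?d x\<bar>)"
    using r by (intro continuous_intros continuous_abs_powr continuous_derivative) auto
  then have "integrable lborel (\<lambda>x. r * \<bar>u x\<bar> powr (r - 1) * \<bar>?d x\<bar>)"
    by (intro integrable_continuous_compact_support[OF compact_support])
       (auto simp: derivative_eq_0_outside_support)
  then have "(\<integral>\<^sup>+ x. ennreal (r * \<bar>u x\<bar> powr (r - 1) * \<bar>?d x\<bar>) \<partial>lborel)
      = ennreal (\<integral>x. r * \<bar>u x\<bar> powr (r - 1) * \<bar>?d x\<bar> \<partial>lborel)"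
    using r by (intro nn_integral_eq_integral) auto
  \<comment> \<open>Cauchy-Schwarz is \<open>Holder_integral\<close> with
    \<open>\<theta> = 1/2\<close>, so both factors are written as square roots.\<close>
  moreover have "(\<integral>x. r * \<bar>u x\<bar> powr (r - 1) * \<bar>?d x\<bar> \<partial>lborel)
      = r * (\<integral>x. (\<bar>u x\<bar> powr (2 * r - 2)) powr (1/2) * ((?d x)\<^sup>2) powr (1 - 1/2) \<partial>lborel)"
    by (simp add: powr_powr powr_half_sqrt mult.assoc diff_divide_distrib)
  moreover have "\<dots> \<le> r * ((\<integral>x. \<bar>u x\<bar> powr (2 * r - 2) \<partial>lborel) powr (1/2)
                       * (\<integral>x. (?d x)\<^sup>2 \<partial>lborel) powr (1 - 1/2))"
    using r by (intro mult_left_mono Holder_integral integrable_abs_powr integrable_derivative_squared) auto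
  ultimately show ?thesis
    by (simp add: powr_half_sqrt ennreal_leI)
qed

end

section \<open>Combining the directional bounds and interpolating\<close>

theorem mainTheorem3:
  fixes r :: real and u :: "real ^ 2 \<Rightarrow> real"
  assumes "r \<ge> 2" and "u \<in> test_functions"
  shows "(Lp_norm (2 * r) u)\<^sup>2 \<le> r / sqrt 2 * Lp_norm r u * Lp_norm 2 (gradient u)"
proof -
  interpret test_function u
    using assms(2) by unfold_locales
  let ?e1 = "axis 1 1 :: real ^ 2" and ?e2 = "axis 2 1 :: real ^ 2"
  let ?k = "\<lambda>b x. ennreal (r * \<bar>u x\<bar> powr (r - 1) * \<bar>frechet_derivative u (at x) b\<bar>)"
  \<comment> \<open>\<open>A\<close>, \<open>B\<close> and the sum of the two \<open>D\<close> are
    the integrals behind the three norms; \<open>W\<close> comes from Cauchy-Schwarz and is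
    eliminated by interpolation.\<close>
  define A where "A = (\<integral>x. \<bar>u x\<bar> powr (2 * r) \<partial>lborel)"
  define B where "B = (\<integral>x. \<bar>u x\<bar> powr r \<partial>lborel)"
  define W where "W = (\<integral>x. \<bar>u x\<bar> powr (2 * r - 2) \<partial>lborel)"
  define D where "D b = (\<integral>x. (frechet_derivative u (at x) b)\<^sup>2 \<partial>lborel)" for b
  have nonneg: "A \<ge> 0" "B \<ge> 0" "W \<ge> 0" "D b \<ge> 0" for b
    by (auto simp: A_def B_def W_def D_def)
  have [measurable]: "u \<in> borel_measurable borel"
    "(\<lambda>x. frechet_derivative u (at x) v) \<in> borel_measurable borel" for v
    using continuous continuous_derivative by (auto intro: borel_measurable_continuous_onI)
  have "ennreal A = (\<integral>\<^sup>+ x. ennreal (\<bar>u x\<bar> powr (2 * r)) \<partial>lborel)"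
    unfolding A_def using assms(1)
    by (intro nn_integral_eq_integral[symmetric] integrable_abs_powr) auto
  also have "\<dots> = (\<integral>\<^sup>+ x. ennreal (\<bar>u x\<bar> powr r) * ennreal (\<bar>u x\<bar> powr r) \<partial>lborel)"
    by (simp add: ennreal_mult[symmetric] powr_add[symmetric])
  also have "\<dots> \<le> (\<integral>\<^sup>+ x. ?k ?e1 x \<partial>lborel) * (\<integral>\<^sup>+ x. ?k ?e2 x \<partial>lborel)"
  proof (rule nn_integral_plane_square_le)
    fix s t
    show "ennreal (\<bar>u (plane_point s t)\<bar> powr r) \<le> (\<integral>\<^sup>+ \<sigma>. ?k ?e1 (plane_point \<sigma> t) \<partial>lborel)"
      \<comment> \<open>The horizontal line through the point is based at
        \<open>t *\<^sub>R ?e2\<close> and has direction \<open>?e1\<close>.\<close>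
      using line_bound[of r ?e1 "t *\<^sub>R ?e2" s] assms(1)
      by (simp add: plane_point_def add.commute axis_eq_0_iff)
    show "ennreal (\<bar>u (plane_point s t)\<bar> powr r) \<le> (\<integral>\<^sup>+ \<tau>. ?k ?e2 (plane_point s \<tau>) \<partial>lborel)"
      using line_bound[of r ?e2 "s *\<^sub>R ?e1" t] assms(1)
      by (simp add: plane_point_def axis_eq_0_iff)
  qed measurable
  also have "\<dots> \<le> ennreal (r * (sqrt W * sqrt (D ?e1))) * ennreal (r * (sqrt W * sqrt (D ?e2)))"
    unfolding W_def D_def using assms(1) by (intro mult_mono integral_derivative_le) auto
  also have "\<dots> = ennreal ((r * (sqrt W * sqrt (D ?e1))) * (r * (sqrt W * sqrt (D ?e2))))"
    using assms(1) nonneg by (intro ennreal_mult[symmetric]) auto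
  finally have "A \<le> (r * (sqrt W * sqrt (D ?e1))) * (r * (sqrt W * sqrt (D ?e2)))"
    using assms(1) nonneg by (subst (asm) ennreal_le_iff) auto
  also have "\<dots> = r\<^sup>2 * W * sqrt (D ?e1 * D ?e2)"
    using nonneg by (simp add: power2_eq_square real_sqrt_mult)
  also have "\<dots> \<le> r\<^sup>2 * W * ((D ?e1 + D ?e2) / 2)"
    using nonneg by (intro mult_left_mono arith_geo_mean_sqrt) auto
  \<comment> \<open>The weight \<open>2 / r\<close> solves
    \<open>r * \<theta> + 2 * r * (1 - \<theta>) = 2 * r - 2\<close>; it is at most 1 because
    \<open>r \<ge> 2\<close>.\<close>
  also have "W \<le> B powr (2 / r) * A powr (1 - 2 / r)"
  proof -
    have "W = (\<integral>x. (\<bar>u x\<bar> powr r) powr (2 / r) * (\<bar>u x\<bar> powr (2 * r)) powr (1 - 2 / r) \<partial>lborel)"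
      unfolding W_def using assms(1)
      by (simp only: powr_powr powr_add[symmetric]) (simp add: right_diff_distrib)
    also have "\<dots> \<le> B powr (2 / r) * A powr (1 - 2 / r)"
      unfolding A_def B_def using assms(1) by (intro Holder_integral integrable_abs_powr) auto
    finally show ?thesis .
  qed
  finally have main: "A \<le> r\<^sup>2 * (B powr (2 / r) * A powr (1 - 2 / r)) * ((D ?e1 + D ?e2) / 2)"
    using nonneg by (simp add: mult_left_mono mult_right_mono)
  have "A powr (2 / r) \<le> r\<^sup>2 / 2 * B powr (2 / r) * (D ?e1 + D ?e2)"
  \<comment> \<open>The power of \<open>A\<close> on the right of \<open>main\<close> can be
    cancelled only for \<open>A > 0\<close>; for \<open>A = 0\<close> the left-hand side is
    0.\<close>
  proof (cases "A = 0")
    case True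
    then show ?thesis
      using nonneg by simp
  next
    case False
    then have "A > 0"
      using nonneg by simp
    have "A powr (2 / r) * A powr (1 - 2 / r) = A"
      using \<open>A > 0\<close> by (simp add: powr_add[symmetric])
    also note main
    finally have "A powr (2 / r) * A powr (1 - 2 / r)
        \<le> (r\<^sup>2 / 2 * B powr (2 / r) * (D ?e1 + D ?e2)) * A powr (1 - 2 / r)"
      by (simp add: algebra_simps)
    then show ?thesis
      using \<open>A > 0\<close> by simp
  qed
  \<comment> \<open>The claim is compared after squaring both sides, which removes the roots from
    the gradient norm and from \<open>r / sqrt 2\<close>.\<close>
  moreover have "((Lp_norm (2 * r) u)\<^sup>2)\<^sup>2 = A powr (2 / r)"
    by (simp add: Lp_norm_def A_def powr_power[symmetric] powr_powr power2_eq_square powr_add[symmetric])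
  moreover have "(Lp_norm r u)\<^sup>2 = B powr (2 / r)"
    by (simp add: Lp_norm_def B_def power2_eq_square powr_add[symmetric])
  moreover have "(Lp_norm 2 (gradient u))\<^sup>2 = D ?e1 + D ?e2"
  proof -
    have "norm (gradient u x) powr 2
        = (frechet_derivative u (at x) ?e1)\<^sup>2 + (frechet_derivative u (at x) ?e2)\<^sup>2" for x
      using axis_1_neq_axis_2 norm_gradient_squared[of u x] by (simp add: Basis_real2)
    then have "(\<integral>x. norm (gradient u x) powr 2 \<partial>lborel) = D ?e1 + D ?e2"
      by (simp add: D_def integrable_derivative_squared)
    then show ?thesis
      using nonneg by (simp add: Lp_norm_def powr_half_sqrt)
  qed
  ultimately have "((Lp_norm (2 * r) u)\<^sup>2)\<^sup>2 \<le> (r / sqrt 2 * Lp_norm r u * Lp_norm 2 (gradient u))\<^sup>2"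
    by (simp add: power_mult_distrib power_divide)
  then show ?thesis
    by (rule power2_le_imp_le) (use assms(1) in \<open>auto simp: Lp_norm_def\<close>)
qed

end
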